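(* Let $R$ be a commutative ring, let $A$ be a commutative associative unital $R$-algebra and let $\tau,\sigma : A \to A$ be different $R$-algebra endomorphisms with $\tau$ invertible. Let $\Delta$ be a $(\tau,\sigma)$-derivation of $A$. If $$(\sigma \circ \tau^{-1})(\operatorname{Ann}(\Delta)) \subseteq \operatorname{Ann}(\Delta),$$ then the map $[\cdot,\cdot]_{\tau,\sigma} : A \cdot \Delta \times A \cdot \Delta \to A \cdot \Delta$ defined by setting $$[a \cdot \Delta,b \cdot \Delta]_{\tau,\sigma} := \big((\sigma \circ \tau^{-1})(a) \cdot \Delta\big) \circ \big(\tau^{-1}(b) \cdot (\tau^{-1} \circ \Delta)\big) - \big((\sigma \circ \tau^{-1})(b) \cdot \Delta\big) \circ \big(\tau^{-1}(a) \cdot (\tau^{-1} \circ \Delta)\big)$$ for $a,b \in A$ is a well-defined $R$-algebra bracket (i.e. a well-defined $R$-bilinear map with values in $A\cdot\Delta$) on the $R$-linear space $A \cdot \Delta$, and it satisfies, for all $a,b \in A$: $$[a \cdot \Delta,b \cdot \Delta]_{\tau,\sigma} = \Big( (\sigma \circ \tau^{-1})(a)\, (\Delta \circ \tau^{-1})(b) - (\sigma \circ \tau^{-1})(b)\, (\Delta \circ \tau^{-1})(a) \Big) \cdot \Delta ,$$ $$[b \cdot \Delta,a \cdot \Delta]_{\tau,\sigma} = - [a \cdot \Delta,b \cdot \Delta]_{\tau,\sigma}.$$ Moreover, if there exists an element $\delta \in A$ such that $$\Delta \circ \tau^{-1} \circ \sigma \circ \tau^{-1} = \delta \cdot (\sigma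 \circ \tau^{-1} \circ \Delta \circ \tau^{-1}),$$ then for all $a,b,c\in A$ $$\circlearrowleft_{a,b,c} \Big( [\sigma(\tau^{-1}(a)) \cdot \Delta,[b \cdot \Delta,c \cdot \Delta]_{\tau,\sigma}]_{\tau,\sigma} + \delta \cdot [a \cdot \Delta,[b \cdot \Delta,c \cdot \Delta]_{\tau,\sigma}]_{\tau,\sigma} \Big) = 0.$$
   Context: An $R$-algebra endomorphism is an $R$-linear multiplicative map. A $(\tau,\sigma)$-derivation of $A$ is an $R$-linear map $D : A \to A$ with $D(ab)=D(a)\tau(b)+\sigma(a)D(b)$ for all $a,b\in A$. For an $R$-linear map $D:A\to A$ and $a\in A$, $a\cdot D$ is the map $x \mapsto aD(x)$. $A\cdot\Delta = \{a\cdot\Delta : a\in A\}$, and $\operatorname{Ann}(\Delta) = \{a\in A : a\cdot\Delta = 0\}$. The symbol $\circlearrowleft_{a,b,c}$ denotes the sum over cyclic permutations of $(a,b,c)$. *)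

theory Defs
  imports Complex_Main "HOL-Library.Function_Algebras"
begin

text \<open>
  Maps \<open>A \<Rightarrow> A\<close> carry the pointwise additive structure of Function_Algebras.
  The class \<^class>\<open>comm_ring_1\<close> demands \<open>0 \<noteq> 1\<close>. This excludes nothing where two
  different endomorphisms of \<open>A\<close> are given: then \<open>A\<close> has two different elements, so
  \<open>0 \<noteq> 1\<close> in \<open>A\<close> and therefore also in \<open>R\<close>.
\<close>

locale comm_algebra = module scale
  for scale :: "'r::comm_ring_1 \<Rightarrow> 'a::comm_ring_1 \<Rightarrow> 'a" +
  assumes scale_mult_left: "scale r (a * b) = scale r a * b"

text \<open>Endomorphisms are not required to preserve \<open>1\<close>.\<close>

definition algebra_endo :: "('r::comm_ring_1 \<Rightarrow> 'a::comm_ring_1 \<Rightarrow> 'a) \<Rightarrow> ('a \<Rightarrow> 'a) \<Rightarrow> bool"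
  where "algebra_endo scale f \<longleftrightarrow>
    module_hom scale scale f \<and> (\<forall>a b. f (a * b) = f a * f b)"

definition twisted_derivation ::
    "('r::comm_ring_1 \<Rightarrow> 'a::comm_ring_1 \<Rightarrow> 'a) \<Rightarrow> ('a \<Rightarrow> 'a) \<Rightarrow> ('a \<Rightarrow> 'a) \<Rightarrow> ('a \<Rightarrow> 'a) \<Rightarrow> bool"
  where "twisted_derivation scale \<tau> \<sigma> D \<longleftrightarrow>
    module_hom scale scale D \<and> (\<forall>a b. D (a * b) = D a * \<tau> b + \<sigma> a * D b)"

definition map_mult :: "'a::comm_ring_1 \<Rightarrow> ('a \<Rightarrow> 'a) \<Rightarrow> ('a \<Rightarrow> 'a)"  (infixr "\<cdot>" 75)
  where "a \<cdot> D = (\<lambda>x. a * D x)"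

definition map_scale :: "('r \<Rightarrow> 'a \<Rightarrow> 'a) \<Rightarrow> 'r \<Rightarrow> ('a \<Rightarrow> 'a) \<Rightarrow> ('a \<Rightarrow> 'a)"
  where "map_scale scale r D = (\<lambda>x. scale r (D x))"

definition multiples :: "('a::comm_ring_1 \<Rightarrow> 'a) \<Rightarrow> ('a \<Rightarrow> 'a) set"
  where "multiples D = {a \<cdot> D | a. True}"

definition Ann :: "('a::comm_ring_1 \<Rightarrow> 'a) \<Rightarrow> 'a set"
  where "Ann D = {a. a \<cdot> D = 0}"

text \<open>An algebra bracket on a subset \<open>S\<close> of a module: \<open>S\<close> is a submodule, and \<open>B\<close>,
  of which only the values on \<open>S \<times> S\<close> matter, is a bilinear map \<open>S \<times> S \<rightarrow> S\<close>.\<close>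

definition algebra_bracket_on ::
    "('r::comm_ring_1 \<Rightarrow> 'm::ab_group_add \<Rightarrow> 'm) \<Rightarrow> 'm set \<Rightarrow> ('m \<Rightarrow> 'm \<Rightarrow> 'm) \<Rightarrow> bool"
  where "algebra_bracket_on scl S B \<longleftrightarrow>
    module scl \<and> module.subspace scl S \<and>
    (\<forall>F\<in>S. \<forall>G\<in>S. B F G \<in> S) \<and>
    (\<forall>F\<in>S. \<forall>F'\<in>S. \<forall>G\<in>S. B (F + F') G = B F G + B F' G) \<and>
    (\<forall>F\<in>S. \<forall>G\<in>S. \<forall>G'\<in>S. B F (G + G') = B F G + B F G') \<and>
    (\<forall>r. \<forall>F\<in>S. \<forall>G\<in>S. B (scl r F) G = scl r (B F G)) \<and>
    (\<forall>r. \<forall>F\<in>S. \<forall>G\<in>S. B F (scl r G) = scl r (B F G))"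

text \<open>The defining expression in terms of the coefficients \<open>a\<close> and \<open>b\<close>.\<close>

definition bracket_expr ::
    "('a::comm_ring_1 \<Rightarrow> 'a) \<Rightarrow> ('a \<Rightarrow> 'a) \<Rightarrow> ('a \<Rightarrow> 'a) \<Rightarrow> 'a \<Rightarrow> 'a \<Rightarrow> ('a \<Rightarrow> 'a)"
  where "bracket_expr \<tau> \<sigma> \<Delta> a b =
    (((\<sigma> \<circ> inv \<tau>) a \<cdot> \<Delta>) \<circ> (inv \<tau> b \<cdot> (inv \<tau> \<circ> \<Delta>))) -
    (((\<sigma> \<circ> inv \<tau>) b \<cdot> \<Delta>) \<circ> (inv \<tau> a \<cdot> (inv \<tau> \<circ> \<Delta>)))"

text \<open>The graph of the assignment \<open>(a \<cdot> \<Delta>, b \<cdot> \<Delta>) \<mapsto> bracket_expr \<tau> \<sigma> \<Delta> a b\<close>. That the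
  bracket is well-defined means that each pair of multiples of \<open>\<Delta>\<close> is related to exactly
  one \<open>H\<close>; otherwise the description operator in \<open>bracket\<close> has no meaning.\<close>

definition bracket_graph ::
    "('a::comm_ring_1 \<Rightarrow> 'a) \<Rightarrow> ('a \<Rightarrow> 'a) \<Rightarrow> ('a \<Rightarrow> 'a) \<Rightarrow>
      ('a \<Rightarrow> 'a) \<Rightarrow> ('a \<Rightarrow> 'a) \<Rightarrow> ('a \<Rightarrow> 'a) \<Rightarrow> bool"
  where "bracket_graph \<tau> \<sigma> \<Delta> F G H \<longleftrightarrow>
    (\<exists>a b. F = a \<cdot> \<Delta> \<and> G = b \<cdot> \<Delta> \<and> H = bracket_expr \<tau> \<sigma> \<Delta> a b)"

definition bracket ::
    "('a::comm_ring_1 \<Rightarrow> 'a) \<Rightarrow> ('a \<Rightarrow> 'a) \<Rightarrow> ('a \<Rightarrow> 'a) \<Rightarrow>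
      ('a \<Rightarrow> 'a) \<Rightarrow> ('a \<Rightarrow> 'a) \<Rightarrow> ('a \<Rightarrow> 'a)"
  where "bracket \<tau> \<sigma> \<Delta> F G = (THE H. bracket_graph \<tau> \<sigma> \<Delta> F G H)"

definition cyclic_sum :: "('a \<Rightarrow> 'a \<Rightarrow> 'a \<Rightarrow> 'm::ab_group_add) \<Rightarrow> 'a \<Rightarrow> 'a \<Rightarrow> 'a \<Rightarrow> 'm"
  where "cyclic_sum f a b c = f a b c + f b c a + f c a b"

end

theory Submission
  imports Defs
begin

text \<open>
  Put \<open>s = \<sigma> \<circ> \<tau>\<^sup>-\<^sup>1\<close> and \<open>D = \<Delta> \<circ> \<tau>\<^sup>-\<^sup>1\<close>. Then \<open>D\<close> is an \<open>(id, s)\<close>-derivation, and the second-order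
  terms \<open>s a * s b * D (\<Delta> x)\<close> in the defining expression cancel, so the bracket
  has coefficient \<open>s a * D b - s b * D a\<close>. If \<open>a \<cdot> \<Delta> = 0\<close>, then applying \<open>D\<close> to \<open>a * \<Delta> x = 0\<close>
  and using that \<open>s a\<close> annihilates \<open>\<Delta>\<close> gives \<open>D a * \<Delta> x = 0\<close>, hence well-definedness. The Jacobi
  identity already holds for the coefficients. Expanding \<open>D (s b * D c)\<close> by the Leibniz rule in one
  order for the summand with \<open>s a\<close> and in the other order for the summand with \<open>\<delta>\<close> makes
  the terms in \<open>D (D c)\<close> cancel cyclically.
\<close>

lemma multiplesI [simp, intro]: "a \<cdot> D \<in> multiples D"
  by (auto simp: multiples_def)

lemma map_mult_distrib_right: "(a + b) \<cdot> D = a \<cdot> D + b \<cdot> D"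
  by (simp add: map_mult_def fun_eq_iff distrib_right)

lemma map_mult_diff_right: "(a - b) \<cdot> D = a \<cdot> D - b \<cdot> D"
  by (simp add: map_mult_def fun_eq_iff left_diff_distrib)

lemma map_mult_minus_left: "(- a) \<cdot> D = - (a \<cdot> D)"
  by (simp add: map_mult_def fun_eq_iff)

lemma map_mult_zero_left [simp]: "0 \<cdot> D = 0"
  by (simp add: map_mult_def fun_eq_iff)

lemma map_mult_assoc: "a \<cdot> b \<cdot> D = (a * b) \<cdot> D"
  by (simp add: map_mult_def fun_eq_iff mult.assoc)

text \<open>This turns independence of the chosen coefficient into membership in the
  annihilator.\<close>

lemma map_mult_eq_iff: "a \<cdot> D = b \<cdot> D \<longleftrightarrow> a - b \<in> Ann D"
  by (simp add: Ann_def map_mult_diff_right)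

lemma module_map_scale:
  assumes "module scale"
  shows "module (map_scale scale)"
proof -
  interpret module scale by fact
  show ?thesis
    by unfold_locales
      (simp_all add: map_scale_def fun_eq_iff scale_right_distrib scale_left_distrib)
qed

lemma (in comm_algebra) map_scale_map_mult: "map_scale scale r (a \<cdot> D) = scale r a \<cdot> D"
  by (simp add: map_scale_def map_mult_def fun_eq_iff scale_mult_left)

lemma (in comm_algebra) scale_mult_right: "scale r (a * b) = a * scale r b"
  by (metis mult.commute scale_mult_left)

lemma (in comm_algebra) subspace_multiples:
  "module.subspace (map_scale scale) (multiples D)"
proof -
  interpret M: module "map_scale scale"
    by (rule module_map_scale) (rule module_axioms)
  show ?thesis
  proof (rule M.subspaceI)
    show "0 \<in> multiples D"
      by (metis map_mult_zero_left multiplesI)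
  next
    fix F G assume "F \<in> multiples D" "G \<in> multiples D"
    then show "F + G \<in> multiples D"
      by (auto simp: multiples_def simp flip: map_mult_distrib_right)
  next
    fix r F assume "F \<in> multiples D"
    then show "map_scale scale r F \<in> multiples D"
      by (auto simp: multiples_def map_scale_map_mult)
  qed
qed

text \<open>This isolates what the Jacobi computation needs from
  \<open>\<sigma> \<circ> inv \<tau>\<close> and \<open>\<Delta> \<circ> inv \<tau>\<close>: the
  twist by \<open>\<tau>\<close> is gone, and scalars and annihilators do not enter.\<close>

locale skew_derivation =
  fixes s D :: "'a::comm_ring_1 \<Rightarrow> 'a"
  assumes s_add: "s (a + b) = s a + s b"
    and s_mult: "s (a * b) = s a * s b"
    and D_add: "D (a + b) = D a + D b"
    and D_mult: "D (a * b) = D a * b + s a * D b"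
begin

sublocale s: additive s by unfold_locales (rule s_add)
sublocale D: additive D by unfold_locales (rule D_add)

text \<open>By commutativity the twist can be put on either factor.\<close>

lemma D_mult': "D (a * b) = D a * s b + a * D b"
  using D_mult[of b a] by (simp add: algebra_simps)

definition coeff :: "'a \<Rightarrow> 'a \<Rightarrow> 'a"
  where "coeff a b = s a * D b - s b * D a"

lemma coeff_add_left: "coeff (a + a') b = coeff a b + coeff a' b"
  by (simp add: coeff_def s.add D.add algebra_simps)

lemma coeff_diff_left: "coeff (a - a') b = coeff a b - coeff a' b"
  by (simp add: coeff_def s.diff D.diff algebra_simps)

lemma coeff_skew: "coeff b a = - coeff a b"
  by (simp add: coeff_def)

lemma coeff_add_right: "coeff a (b + b') = coeff a b + coeff a b'"
  using coeff_add_left[of b b' a] by (simp add: coeff_skew[of a])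

lemma coeff_jacobi:
  assumes "\<And>a. D (s a) = \<delta> * s (D a)"
  shows "cyclic_sum (\<lambda>a b c. coeff (s a) (coeff b c) + \<delta> * coeff a (coeff b c)) a b c = 0"
proof -
  \<comment> \<open>With \<open>D_mult\<close>, \<open>D (D c)\<close> gets the factor
    \<open>s (s b)\<close>, which matches the outer factor \<open>s (s a)\<close>: the product is
    symmetric in \<open>a\<close> and \<open>b\<close>.\<close>
  have outer: "coeff (s a) (coeff b c) =
      s (s a) * (\<delta> * s (D b) * D c + s (s b) * D (D c)
        - (\<delta> * s (D c) * D b + s (s c) * D (D b)))
      - (s (s b) * s (D c) - s (s c) * s (D b)) * (\<delta> * s (D a))" for a b c
    by (simp add: coeff_def D.diff s.diff D_mult s_mult assms)
  \<comment> \<open>With \<open>D_mult'\<close>, \<open>D (D c)\<close> gets the factor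
    \<open>s b\<close>, which matches \<open>s a\<close>. The two terms in \<open>\<delta>\<close>
    agree by commutativity and drop out.\<close>
  have inner: "coeff a (coeff b c) =
      s a * (\<delta> * s (D b) * s (D c) + s b * D (D c)
        - (\<delta> * s (D c) * s (D b) + s c * D (D b)))
      - (s (s b) * s (D c) - s (s c) * s (D b)) * D a" for a b c
    unfolding coeff_def[of a] coeff_def[of b]
    by (simp add: D.diff s.diff D_mult' s_mult assms)
  \<comment> \<open>\<open>outer\<close> is rewritten first, since its left-hand side is an instance
    of that of \<open>inner\<close>. The mixed terms
    \<open>\<delta> * s (s a) * s (D b) * D c\<close> cancel between the two kinds of
    summands.\<close>
  show ?thesis
    unfolding cyclic_sum_def outer unfolding inner by (simp add: algebra_simps)
qed

end

locale twisted_derivation_algebra = comm_algebra scale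
  for scale :: "'r::comm_ring_1 \<Rightarrow> 'a::comm_ring_1 \<Rightarrow> 'a" +
  fixes \<tau> \<sigma> \<Delta> :: "'a \<Rightarrow> 'a"
  assumes endo_tau: "algebra_endo scale \<tau>"
    and endo_sigma: "algebra_endo scale \<sigma>"
    and bij_tau: "bij \<tau>"
    and derivation: "twisted_derivation scale \<tau> \<sigma> \<Delta>"
    and Ann_subset: "(\<sigma> \<circ> inv \<tau>) ` Ann \<Delta> \<subseteq> Ann \<Delta>"
begin

sublocale tau: module_hom scale scale \<tau>
  using endo_tau by (simp add: algebra_endo_def)

sublocale sigma: module_hom scale scale \<sigma>
  using endo_sigma by (simp add: algebra_endo_def)

sublocale Delta: module_hom scale scale \<Delta>
  using derivation by (simp add: twisted_derivation_def)

lemma tau_mult: "\<tau> (a * b) = \<tau> a * \<tau> b"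
  and sigma_mult: "\<sigma> (a * b) = \<sigma> a * \<sigma> b"
  and Delta_mult: "\<Delta> (a * b) = \<Delta> a * \<tau> b + \<sigma> a * \<Delta> b"
  using endo_tau endo_sigma derivation by (auto simp: algebra_endo_def twisted_derivation_def)

lemma tau_inv_tau [simp]: "\<tau> (inv \<tau> a) = a"
  using bij_tau by (simp add: bij_is_surj surj_f_inv_f)

lemma inv_tau_eqI: "\<tau> b = a \<Longrightarrow> inv \<tau> a = b"
  using bij_tau by (metis bij_is_inj inv_f_f)

lemma inv_tau_add: "inv \<tau> (a + b) = inv \<tau> a + inv \<tau> b"
  and inv_tau_mult: "inv \<tau> (a * b) = inv \<tau> a * inv \<tau> b"
  and inv_tau_scale: "inv \<tau> (scale r a) = scale r (inv \<tau> a)"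
  by (rule inv_tau_eqI; simp add: tau.add tau_mult tau.scale)+

abbreviation s :: "'a \<Rightarrow> 'a" where "s \<equiv> \<sigma> \<circ> inv \<tau>"
abbreviation D :: "'a \<Rightarrow> 'a" where "D \<equiv> \<Delta> \<circ> inv \<tau>"

text \<open>In the Leibniz rule of \<open>\<Delta>\<close> at
  \<open>inv \<tau> a * inv \<tau> b\<close> the factor \<open>\<tau> (inv \<tau> b)\<close> is just
  \<open>b\<close>.\<close>

sublocale skew_derivation s D
  by unfold_locales
    (simp_all add: inv_tau_add inv_tau_mult sigma.add sigma_mult Delta.add Delta_mult)

text \<open>At \<open>x\<close> the first composite is
  \<open>s a * (D b * \<Delta> x + s b * D (\<Delta> x))\<close>, whose second-order part is
  symmetric in \<open>a\<close> and \<open>b\<close>.\<close>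

lemma bracket_expr_eq: "bracket_expr \<tau> \<sigma> \<Delta> a b = coeff a b \<cdot> \<Delta>"
  by (simp add: bracket_expr_def coeff_def map_mult_def fun_eq_iff Delta_mult algebra_simps)

text \<open>This is where \<open>Ann_subset\<close> enters. It puts \<open>s a\<close> into the
  annihilator, \<open>D a\<close> follows, and so both products in \<open>coeff a b\<close> lie in
  this ideal.\<close>

lemma coeff_in_Ann:
  assumes "a \<in> Ann \<Delta>"
  shows "coeff a b \<in> Ann \<Delta>"
proof -
  have Ann_iff: "c \<in> Ann \<Delta> \<longleftrightarrow> (\<forall>x. c * \<Delta> x = 0)" for c
    by (simp add: Ann_def map_mult_def fun_eq_iff)
  have sa: "s a * \<Delta> x = 0" for x
    using assms Ann_subset Ann_iff[of "s a"] by blast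
  have "D a * \<Delta> x = 0" for x
  proof -
    have "a * \<Delta> x = 0"
      using assms by (simp add: Ann_iff)
    then have "D a * \<Delta> x + s a * D (\<Delta> x) = 0"
      using D_mult[of a "\<Delta> x"] D.zero by simp
    \<comment> \<open>At this instance \<open>sa\<close> kills the second-order term
      \<open>s a * D (\<Delta> x)\<close>.\<close>
    then show ?thesis
      using sa[of "inv \<tau> (\<Delta> x)"] by simp
  qed
  moreover have "coeff a b * \<Delta> x = D b * (s a * \<Delta> x) - s b * (D a * \<Delta> x)" for x
    by (simp add: coeff_def algebra_simps)
  ultimately show ?thesis
    using sa by (simp add: Ann_iff)
qed

lemma coeff_map_mult_cong:
  assumes "a \<cdot> \<Delta> = a' \<cdot> \<Delta>" "b \<cdot> \<Delta> = b' \<cdot> \<Delta>"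
  shows "coeff a b \<cdot> \<Delta> = coeff a' b' \<cdot> \<Delta>"
proof -
  have left: "coeff a b \<cdot> \<Delta> = coeff a' b \<cdot> \<Delta>" if "a \<cdot> \<Delta> = a' \<cdot> \<Delta>" for a a' b
    using that coeff_in_Ann[of "a - a'" b] by (simp add: map_mult_eq_iff coeff_diff_left)
  \<comment> \<open>First \<open>a\<close> is replaced, then \<open>b\<close>: skew-symmetry moves
    \<open>b\<close> into the left argument, where \<open>left\<close> applies.\<close>
  show ?thesis
    using left[OF assms(1), of b] left[OF assms(2), of a']
    by (simp add: coeff_skew[of _ a'] map_mult_minus_left)
qed

text \<open>Other coefficients of the same two maps give the same value by
  \<open>coeff_map_mult_cong\<close>. Hence the graph is functional and \<open>THE\<close> in
  \<open>bracket\<close> has its intended value.\<close>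

lemma bracket_graph_iff:
  "bracket_graph \<tau> \<sigma> \<Delta> (a \<cdot> \<Delta>) (b \<cdot> \<Delta>) H \<longleftrightarrow> H = coeff a b \<cdot> \<Delta>"
  unfolding bracket_graph_def bracket_expr_eq using coeff_map_mult_cong by metis

lemma bracket_eq: "bracket \<tau> \<sigma> \<Delta> (a \<cdot> \<Delta>) (b \<cdot> \<Delta>) = coeff a b \<cdot> \<Delta>"
  by (simp add: bracket_def bracket_graph_iff)

lemma coeff_scale_left: "coeff (scale r a) b = scale r (coeff a b)"
  by (simp add: coeff_def inv_tau_scale sigma.scale Delta.scale scale_right_diff_distrib
      flip: scale_mult_left scale_mult_right)

lemma coeff_scale_right: "coeff a (scale r b) = scale r (coeff a b)"
  using coeff_scale_left[of r b a] by (simp add: coeff_skew[of a])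

lemma algebra_bracket_on_multiples:
  "algebra_bracket_on (map_scale scale) (multiples \<Delta>) (bracket \<tau> \<sigma> \<Delta>)"
  unfolding algebra_bracket_on_def
proof (intro conjI)
  show "module (map_scale scale)"
    by (rule module_map_scale) (rule module_axioms)
  show "module.subspace (map_scale scale) (multiples \<Delta>)"
    by (rule subspace_multiples)
\<comment> \<open>With elements written as \<open>a \<cdot> \<Delta>\<close>,
  \<open>bracket_eq\<close> gives closure and reduces bilinearity to that of
  \<open>coeff\<close>.\<close>
qed (auto simp: multiples_def map_scale_map_mult bracket_eq coeff_add_left coeff_add_right
    coeff_scale_left coeff_scale_right simp flip: map_mult_distrib_right)

lemma bracket_jacobi:
  assumes "D \<circ> s = \<delta> \<cdot> (s \<circ> D)"
  shows "cyclic_sum (\<lambda>a b c.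
      bracket \<tau> \<sigma> \<Delta> (s a \<cdot> \<Delta>) (bracket \<tau> \<sigma> \<Delta> (b \<cdot> \<Delta>) (c \<cdot> \<Delta>)) +
      \<delta> \<cdot> bracket \<tau> \<sigma> \<Delta> (a \<cdot> \<Delta>) (bracket \<tau> \<sigma> \<Delta> (b \<cdot> \<Delta>) (c \<cdot> \<Delta>))) a b c = 0"
proof -
  have "D (s a) = \<delta> * s (D a)" for a
    using fun_cong[OF assms, of a] by (simp add: map_mult_def)
  \<comment> \<open>Each nested bracket is a single coefficient times \<open>\<Delta>\<close>, so
    the whole cyclic sum is this coefficient sum times \<open>\<Delta>\<close>.\<close>
  from coeff_jacobi[OF this] have
    "cyclic_sum (\<lambda>a b c. coeff (s a) (coeff b c) + \<delta> * coeff a (coeff b c)) a b c \<cdot> \<Delta> = 0"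
    by (simp only: map_mult_zero_left)
  then show ?thesis
    by (simp only: cyclic_sum_def bracket_eq map_mult_assoc map_mult_distrib_right)
qed

end

theorem theorem2p1:
  fixes scale :: "'r::comm_ring_1 \<Rightarrow> 'a::comm_ring_1 \<Rightarrow> 'a"
    and \<tau> \<sigma> \<Delta> :: "'a \<Rightarrow> 'a"
  assumes "comm_algebra scale"
    and "algebra_endo scale \<tau>" and "algebra_endo scale \<sigma>"
    and "\<tau> \<noteq> \<sigma>" and "bij \<tau>"
    and "twisted_derivation scale \<tau> \<sigma> \<Delta>"
    and "(\<sigma> \<circ> inv \<tau>) ` Ann \<Delta> \<subseteq> Ann \<Delta>"
  shows "(\<forall>F\<in>multiples \<Delta>. \<forall>G\<in>multiples \<Delta>. \<exists>!H. bracket_graph \<tau> \<sigma> \<Delta> F G H) \<and>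
    algebra_bracket_on (map_scale scale) (multiples \<Delta>) (bracket \<tau> \<sigma> \<Delta>) \<and>
    (\<forall>a b. bracket \<tau> \<sigma> \<Delta> (a \<cdot> \<Delta>) (b \<cdot> \<Delta>) = bracket_expr \<tau> \<sigma> \<Delta> a b) \<and>
    (\<forall>a b. bracket \<tau> \<sigma> \<Delta> (a \<cdot> \<Delta>) (b \<cdot> \<Delta>) =
      ((\<sigma> \<circ> inv \<tau>) a * (\<Delta> \<circ> inv \<tau>) b - (\<sigma> \<circ> inv \<tau>) b * (\<Delta> \<circ> inv \<tau>) a) \<cdot> \<Delta>) \<and>
    (\<forall>a b. bracket \<tau> \<sigma> \<Delta> (b \<cdot> \<Delta>) (a \<cdot> \<Delta>) = - bracket \<tau> \<sigma> \<Delta> (a \<cdot> \<Delta>) (b \<cdot> \<Delta>)) \<and>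
    (\<forall>\<delta>. \<Delta> \<circ> inv \<tau> \<circ> \<sigma> \<circ> inv \<tau> = \<delta> \<cdot> (\<sigma> \<circ> inv \<tau> \<circ> \<Delta> \<circ> inv \<tau>) \<longrightarrow>
      (\<forall>a b c. cyclic_sum (\<lambda>a b c.
          bracket \<tau> \<sigma> \<Delta> (\<sigma> (inv \<tau> a) \<cdot> \<Delta>) (bracket \<tau> \<sigma> \<Delta> (b \<cdot> \<Delta>) (c \<cdot> \<Delta>)) +
          \<delta> \<cdot> bracket \<tau> \<sigma> \<Delta> (a \<cdot> \<Delta>) (bracket \<tau> \<sigma> \<Delta> (b \<cdot> \<Delta>) (c \<cdot> \<Delta>))) a b c = 0))"
proof -
  interpret twisted_derivation_algebra scale \<tau> \<sigma> \<Delta>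
    using assms by (simp add: twisted_derivation_algebra_def twisted_derivation_algebra_axioms_def)
  show ?thesis
  proof (intro conjI allI impI)
    show "\<forall>F\<in>multiples \<Delta>. \<forall>G\<in>multiples \<Delta>. \<exists>!H. bracket_graph \<tau> \<sigma> \<Delta> F G H"
      by (auto simp: multiples_def bracket_graph_iff)
  next
    show "algebra_bracket_on (map_scale scale) (multiples \<Delta>) (bracket \<tau> \<sigma> \<Delta>)"
      by (rule algebra_bracket_on_multiples)
  next
    fix a b
    show "bracket \<tau> \<sigma> \<Delta> (a \<cdot> \<Delta>) (b \<cdot> \<Delta>) = bracket_expr \<tau> \<sigma> \<Delta> a b"
      by (simp only: bracket_eq bracket_expr_eq)
    show "bracket \<tau> \<sigma> \<Delta> (a \<cdot> \<Delta>) (b \<cdot> \<Delta>) = (s a * D b - s b * D a) \<cdot> \<Delta>"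
      by (simp only: bracket_eq coeff_def)
    show "bracket \<tau> \<sigma> \<Delta> (b \<cdot> \<Delta>) (a \<cdot> \<Delta>) = - bracket \<tau> \<sigma> \<Delta> (a \<cdot> \<Delta>) (b \<cdot> \<Delta>)"
      by (simp only: bracket_eq coeff_skew[of b] map_mult_minus_left)
  next
    fix \<delta> a b c
    assume "\<Delta> \<circ> inv \<tau> \<circ> \<sigma> \<circ> inv \<tau> = \<delta> \<cdot> (\<sigma> \<circ> inv \<tau> \<circ> \<Delta> \<circ> inv \<tau>)"
    then have "D \<circ> s = \<delta> \<cdot> (s \<circ> D)"
      by (simp only: comp_assoc)
    from bracket_jacobi[OF this, of a b c]
    show "cyclic_sum (\<lambda>a b c.
        bracket \<tau> \<sigma> \<Delta> (\<sigma> (inv \<tau> a) \<cdot> \<Delta>) (bracket \<tau> \<sigma> \<Delta> (b \<cdot> \<Delta>) (c \<cdot> \<Delta>)) +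
        \<delta> \<cdot> bracket \<tau> \<sigma> \<Delta> (a \<cdot> \<Delta>) (bracket \<tau> \<sigma> \<Delta> (b \<cdot> \<Delta>) (c \<cdot> \<Delta>))) a b c = 0"
      by (simp only: comp_apply)
  qed
qed

end
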